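(* For every $q\in(0,1)$, every $m\in\mathbf{R}$ and every $i\in\{1,2,3\}$, the equilibrium state $e_i^m$ of the fractional-order Lagrange system $$D_t^q x^1(t)=x^2(t)x^3(t),\qquad D_t^q x^2(t)=x^1(t)x^3(t),\qquad D_t^q x^3(t)=x^1(t)x^2(t)$$ is unstable, where $e_1^m=(m,0,0)$, $e_2^m=(0,m,0)$, $e_3^m=(0,0,m)$.
   Context: Superscripts on $x$ denote components, not powers. For $0<q<1$, $D_t^q$ is the Caputo derivative $D_t^q f(t)=\frac{1}{\Gamma(1-q)}\int_0^t (t-s)^{-q}f'(s)\,ds$; solutions with $x(0)=x_0$ of a system $D_t^q x=f(x)$ are understood as continuous solutions of $x(t)=x_0+\frac{1}{\Gamma(q)}\int_0^t (t-s)^{q-1}f(x(s))\,ds$. An equilibrium state $x_e$ (a point with $f(x_e)=0$) is stable if for every $\varepsilon>0$ there is $\delta>0$ such that every solution with $\|x(0)-x_e\|<\delta$ exists for all $t\ge 0$ and satisfies $\|x(t)-x_e\|<\varepsilon$ for all $t\ge0$; it is unstable if it is not stable. *)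

theory Defs
  imports "HOL-Analysis.Analysis"
begin

definition time_interval :: "ereal \<Rightarrow> real set" where
  "time_interval T = {t. 0 \<le> t \<and> ereal t < T}"

definition frac_integral :: "real \<Rightarrow> (real \<Rightarrow> 'a::euclidean_space) \<Rightarrow> real \<Rightarrow> 'a" where
  "frac_integral q g t =
     (1 / Gamma q) *\<^sub>R integral {0..t} (\<lambda>s. ((t - s) powr (q - 1)) *\<^sub>R g s)"

text \<open>
  Solutions on \<open>[0, T)\<close>, where \<open>0 < T \<le> \<infinity>\<close>, of the Caputo system of order \<open>q\<close> with right-hand
  side \<open>f\<close>, in the sense of the Volterra integral equation. For continuous \<open>f\<close> and \<open>0 < q < 1\<close>
  the integrand is absolutely integrable, so the default value of \<open>integral\<close> plays no role.
  Values of \<open>x\<close> outside \<open>[0, T)\<close> are irrelevant.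
\<close>
definition frac_solution ::
    "real \<Rightarrow> ('a::euclidean_space \<Rightarrow> 'a) \<Rightarrow> ereal \<Rightarrow> (real \<Rightarrow> 'a) \<Rightarrow> bool" where
  "frac_solution q f T x \<longleftrightarrow>
     0 < T \<and>
     continuous_on (time_interval T) x \<and>
     (\<forall>t \<in> time_interval T. x t = x 0 + frac_integral q (\<lambda>s. f (x s)) t)"

definition maximal_frac_solution ::
    "real \<Rightarrow> ('a::euclidean_space \<Rightarrow> 'a) \<Rightarrow> ereal \<Rightarrow> (real \<Rightarrow> 'a) \<Rightarrow> bool" where
  "maximal_frac_solution q f T x \<longleftrightarrow>
     frac_solution q f T x \<and>
     \<not> (\<exists>T' y. T < T' \<and> frac_solution q f T' y \<and> (\<forall>t \<in> time_interval T. y t = x t))"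

definition equilibrium_state :: "('a::euclidean_space \<Rightarrow> 'a) \<Rightarrow> 'a \<Rightarrow> bool" where
  "equilibrium_state f xe \<longleftrightarrow> f xe = 0"

text \<open>
  That a solution \<open>exists for all t \<ge> 0\<close> is a statement about solutions that cannot be continued:
  a non-continuable solution must have \<open>T = \<infinity>\<close>.
\<close>
definition stable_state :: "real \<Rightarrow> ('a::euclidean_space \<Rightarrow> 'a) \<Rightarrow> 'a \<Rightarrow> bool" where
  "stable_state q f xe \<longleftrightarrow>
     (\<forall>\<epsilon>>0. \<exists>\<delta>>0. \<forall>T x.
        maximal_frac_solution q f T x \<and> norm (x 0 - xe) < \<delta> \<longrightarrow>
        T = \<infinity> \<and> (\<forall>t\<ge>0. norm (x t - xe) < \<epsilon>))"

definition unstable_state :: "real \<Rightarrow> ('a::euclidean_space \<Rightarrow> 'a) \<Rightarrow> 'a \<Rightarrow> bool" where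
  "unstable_state q f xe \<longleftrightarrow> \<not> stable_state q f xe"

definition lagrange :: "real ^ 3 \<Rightarrow> real ^ 3" where
  "lagrange x = vector [x $ 2 * x $ 3, x $ 1 * x $ 3, x $ 1 * x $ 2]"

text \<open>The index type \<open>3\<close> has exactly the elements \<open>1\<close>, \<open>2\<close>, \<open>3\<close> (with \<open>3 = 0\<close>).\<close>
definition lagrange_state :: "3 \<Rightarrow> real \<Rightarrow> real ^ 3" where
  "lagrange_state i m = axis i m"

lemma lagrange_state_simps:
  "lagrange_state 1 m = vector [m, 0, 0]"
  "lagrange_state 2 m = vector [0, m, 0]"
  "lagrange_state 3 m = vector [0, 0, m]"
  by (simp_all add: lagrange_state_def vec_eq_iff forall_3 axis_def)

end

theory Submission
  imports Defs
begin

text \<open>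
  Choose signs \<open>\<sigma>\<close> with \<open>\<sigma>\<^sub>1 \<sigma>\<^sub>2 \<sigma>\<^sub>3 = 1\<close>; the system is invariant under multiplication of the
  components by \<open>\<sigma>\<close>. If \<open>u\<^sub>k = \<sigma>\<^sub>k x\<^sup>k\<close> are all positive at time \<open>0\<close>, then by a first-exit argument
  they never drop below their initial values, so the right-hand sides stay above some \<open>c\<^sup>2 > 0\<close> and
  \<open>u\<^sub>1\<close> grows at least like \<open>c\<^sup>2 t\<^sup>q / \<Gamma>(q + 1)\<close>. Since \<open>\<sigma>\<close> can be chosen so that \<open>\<sigma>\<^sub>i m \<ge> 0\<close>, such
  initial values \<open>e\<^sub>i\<^sup>m + d \<sigma>\<close> lie arbitrarily close to the equilibrium. A non-continuable solution
  through them comes from Picard iteration on a short interval and Zorn's lemma, so stability would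
  make it global and bounded.
\<close>

section \<open>Riemann--Liouville integrals\<close>

text \<open>The reflection \<open>s\<close> to \<open>t - s\<close> turns the kernel into a power
  integrated from 0. Since \<open>q * Gamma q\<close> is the value of \<open>Gamma\<close> at
  \<open>q + 1\<close>, this is the source of the factor \<open>t powr q / (q * Gamma q)\<close> in
  the bounds below.\<close>

lemma kernel_has_integral:
  fixes q t :: real
  assumes "0 < q" "0 \<le> t"
  shows "((\<lambda>s. (t - s) powr (q - 1)) has_integral t powr q / q) {0..t}"
proof -
  have "((\<lambda>x. x powr (q - 1)) has_integral t powr q / q) (cbox 0 t)"
    using has_integral_powr_from_0[of "q - 1" t] assms by simp
  from has_integral_affinity[OF this, of "-1" t]
  have *: "((\<lambda>s. (t - s) powr (q - 1)) has_integral t powr q / q) ((\<lambda>x. t - x) ` {0..t})"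
    by simp
  have "(\<lambda>x. t - x) ` {0..t} = {0..t}"
    by simp
  with * show ?thesis by simp
qed

lemma kernel_mult_integrable:
  fixes g :: "real \<Rightarrow> 'a::euclidean_space"
  assumes "0 < q" "0 \<le> t" "continuous_on {0..t} g"
  shows "(\<lambda>s. (t - s) powr (q - 1) *\<^sub>R g s) integrable_on {0..t}"
proof -
  have ker: "(\<lambda>s. (t - s) powr (q - 1)) absolutely_integrable_on {0..t}"
    using kernel_has_integral[OF assms(1,2)]
    by (intro nonnegative_absolutely_integrable_1) (auto simp: integrable_on_def)
  have bil: "bilinear (\<lambda>(x::'a) (c::real). c *\<^sub>R x)"
    by (auto simp: bilinear_def linear_iff algebra_simps)
  have meas: "g \<in> borel_measurable (lebesgue_on {0..t})"
    using assms(3) by (intro continuous_imp_measurable_on_sets_lebesgue) auto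
  have bou: "bounded (g ` {0..t})"
    using assms(3) by (intro compact_imp_bounded compact_continuous_image) auto
  have "(\<lambda>s. (t - s) powr (q - 1) *\<^sub>R g s) absolutely_integrable_on {0..t}"
    using absolutely_integrable_bounded_measurable_product[OF bil meas _ bou ker] by simp
  then show ?thesis
    by (simp add: absolutely_integrable_on_def)
qed

lemma frac_integral_0 [simp]: "frac_integral q g 0 = 0"
  by (simp add: frac_integral_def)

lemma frac_integral_cong:
  assumes "\<And>s. s \<in> {0..t} \<Longrightarrow> g s = h s"
  shows "frac_integral q g t = frac_integral q h t"
proof -
  have "integral {0..t} (\<lambda>s. (t - s) powr (q - 1) *\<^sub>R g s) =
        integral {0..t} (\<lambda>s. (t - s) powr (q - 1) *\<^sub>R h s)"
    by (rule Henstock_Kurzweil_Integration.integral_cong) (simp add: assms)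
  then show ?thesis by (simp add: frac_integral_def)
qed

lemma frac_integral_diff:
  fixes g h :: "real \<Rightarrow> 'a::euclidean_space"
  assumes "0 < q" "0 \<le> t" "continuous_on {0..t} g" "continuous_on {0..t} h"
  shows "frac_integral q (\<lambda>s. g s - h s) t = frac_integral q g t - frac_integral q h t"
  unfolding frac_integral_def
  by (simp add: scaleR_diff_right Henstock_Kurzweil_Integration.integral_diff
      kernel_mult_integrable assms)

lemma frac_integral_component:
  fixes g :: "real \<Rightarrow> real ^ 'n"
  assumes "0 < q" "0 \<le> t" "continuous_on {0..t} g"
  shows "frac_integral q g t $ k = frac_integral q (\<lambda>s. g s $ k) t"
  using integral_component_eq_cart[OF kernel_mult_integrable[OF assms], of k]
  by (simp add: frac_integral_def)

lemma frac_integral_cmult: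
  fixes g :: "real \<Rightarrow> real"
  shows "frac_integral q (\<lambda>s. c * g s) t = c * frac_integral q g t"
  by (simp add: frac_integral_def mult.left_commute)

lemma norm_frac_integral_le:
  fixes g :: "real \<Rightarrow> 'a::euclidean_space"
  assumes "0 < q" "0 \<le> t" "continuous_on {0..t} g" "\<And>s. s \<in> {0..t} \<Longrightarrow> norm (g s) \<le> B"
  shows "norm (frac_integral q g t) \<le> B * t powr q / (q * Gamma q)"
proof -
  have ker: "((\<lambda>s. (t - s) powr (q - 1) * B) has_integral t powr q / q * B) {0..t}"
    by (intro has_integral_mult_left kernel_has_integral assms)
  have "norm (integral {0..t} (\<lambda>s. (t - s) powr (q - 1) *\<^sub>R g s))
      \<le> integral {0..t} (\<lambda>s. (t - s) powr (q - 1) * B)"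
    using ker assms
    by (intro integral_norm_bound_integral kernel_mult_integrable)
       (auto simp: integrable_on_def intro!: mult_left_mono)
  also have "\<dots> = t powr q / q * B"
    using ker by (rule integral_unique)
  finally have le: "norm (integral {0..t} (\<lambda>s. (t - s) powr (q - 1) *\<^sub>R g s)) \<le> t powr q / q * B" .
  have "Gamma q > 0" using assms by (simp add: Gamma_real_pos)
  then show ?thesis
    using divide_right_mono[OF le, of "Gamma q"]
    by (simp add: frac_integral_def mult_ac)
qed

text \<open>The lower bound is asked for on the half-open interval so that first-exit arguments can
  apply it at the exit time itself. At \<open>s = t\<close> both integrands vanish, because
  \<open>0 powr (q - 1) = 0\<close>.\<close>

lemma frac_integral_ge:
  fixes g :: "real \<Rightarrow> real"
  assumes "0 < q" "0 \<le> t" "continuous_on {0..t} g" "\<And>s. s \<in> {0..<t} \<Longrightarrow> c \<le> g s"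
  shows "c * t powr q / (q * Gamma q) \<le> frac_integral q g t"
proof -
  have ker: "((\<lambda>s. (t - s) powr (q - 1) * c) has_integral t powr q / q * c) {0..t}"
    by (intro has_integral_mult_left kernel_has_integral assms)
  have "(t - s) powr (q - 1) * c \<le> (t - s) powr (q - 1) *\<^sub>R g s" if "s \<in> {0..t}" for s
    using assms(4)[of s] that by (cases "s = t") (auto intro!: mult_left_mono)
  then have "t powr q / q * c \<le> integral {0..t} (\<lambda>s. (t - s) powr (q - 1) *\<^sub>R g s)"
    using has_integral_le[OF ker integrable_integral[OF kernel_mult_integrable[OF assms(1-3)]]]
    by blast
  moreover have "Gamma q > 0" using assms by (simp add: Gamma_real_pos)
  ultimately show ?thesis
    using divide_right_mono[of "t powr q / q * c" _ "Gamma q"]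
    by (simp add: frac_integral_def mult_ac)
qed

text \<open>The substitution \<open>s = t * u\<close> fixes the interval and the singular kernel.
  What still depends on \<open>t\<close> is a power factor and the argument of \<open>g\<close>,
  which makes continuity in \<open>t\<close> accessible.\<close>

lemma frac_integral_rescale:
  fixes g :: "real \<Rightarrow> 'a::euclidean_space"
  assumes "0 < q" "0 \<le> t"
  shows "frac_integral q g t = t powr q *\<^sub>R frac_integral q (\<lambda>u. g (t * u)) 1"
proof (cases "t = 0")
  case False
  with assms have t: "t > 0" by simp
  have im: "(\<lambda>x. x / t) ` {0..t} = {0..1}"
    using t by simp
  have "(t - t * u) powr (q - 1) = t powr (q - 1) * (1 - u) powr (q - 1)" if "u \<in> {0..1}" for u
    using t that powr_mult[of t "1 - u" "q - 1"] by (simp add: algebra_simps)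
  then have "integral {0..1} (\<lambda>u. (t - t * u) powr (q - 1) *\<^sub>R g (t * u)) =
      integral {0..1} (\<lambda>u. t powr (q - 1) *\<^sub>R ((1 - u) powr (q - 1) *\<^sub>R g (t * u)))"
    by (intro Henstock_Kurzweil_Integration.integral_cong) simp
  moreover have "integral {0..1} (\<lambda>u. (t - t * u) powr (q - 1) *\<^sub>R g (t * u)) =
      (1 / t) *\<^sub>R integral {0..t} (\<lambda>s. (t - s) powr (q - 1) *\<^sub>R g s)"
      (is "_ = _ *\<^sub>R ?I")
    using integral_stretch_real[of t 0 t "\<lambda>s. (t - s) powr (q - 1) *\<^sub>R g s"] t
    by (simp add: im)
  ultimately have "(1 / t) *\<^sub>R ?I =
      t powr (q - 1) *\<^sub>R integral {0..1} (\<lambda>u. (1 - u) powr (q - 1) *\<^sub>R g (t * u))"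
    by (simp only: Henstock_Kurzweil_Integration.integral_cmul)
  then have "t *\<^sub>R (1 / t) *\<^sub>R ?I = t *\<^sub>R
      t powr (q - 1) *\<^sub>R integral {0..1} (\<lambda>u. (1 - u) powr (q - 1) *\<^sub>R g (t * u))"
    by (rule arg_cong)
  then have "?I =
      (t * t powr (q - 1)) *\<^sub>R integral {0..1} (\<lambda>u. (1 - u) powr (q - 1) *\<^sub>R g (t * u))"
    using t by simp
  moreover have "t * t powr (q - 1) = t powr q"
    using t by (simp add: powr_diff)
  ultimately show ?thesis
    by (simp add: frac_integral_def)
qed simp

lemma continuous_on_frac_integral:
  fixes g :: "real \<Rightarrow> 'a::euclidean_space"
  assumes q: "0 < q" and g: "continuous_on {0..h} g"
  shows "continuous_on {0..h} (frac_integral q g)"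
proof -
  have gt: "continuous_on {0..1} (\<lambda>u. g (t * u))" if "t \<in> {0..h}" for t
    using that
    by (intro continuous_on_compose2[OF g] continuous_intros)
       (auto intro: order_trans[OF mult_left_le])
  have "continuous_on {0..h} (\<lambda>t. frac_integral q (\<lambda>u. g (t * u)) 1)"
    unfolding continuous_on_iff
  proof (intro ballI allI impI)
    fix t e :: real assume t: "t \<in> {0..h}" and e: "e > 0"
    have "Gamma q > 0" using q by (simp add: Gamma_real_pos)
    then have G: "q * Gamma q > 0" using q by simp
    then have e': "e * (q * Gamma q) / 2 > 0" using e by simp
    \<comment> \<open>Uniform continuity makes the two rescaled integrands close for all
      \<open>u\<close> at once; the tolerance is chosen so that the norm bound for the fractional
      integral yields \<open>e / 2\<close>.\<close>
    have "uniformly_continuous_on {0..h} g"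
      by (intro compact_uniformly_continuous g) auto
    then obtain d where d: "d > 0"
      and dd: "\<And>a b. a \<in> {0..h} \<Longrightarrow> b \<in> {0..h} \<Longrightarrow> dist a b < d \<Longrightarrow>
        dist (g a) (g b) < e * (q * Gamma q) / 2"
      using e' unfolding uniformly_continuous_on_def by metis
    have "dist (frac_integral q (\<lambda>u. g (t' * u)) 1) (frac_integral q (\<lambda>u. g (t * u)) 1) < e"
      if t': "t' \<in> {0..h}" "dist t' t < d" for t'
    proof -
      have "norm (frac_integral q (\<lambda>u. g (t' * u) - g (t * u)) 1)
          \<le> (e * (q * Gamma q) / 2) * 1 powr q / (q * Gamma q)"
      proof (rule norm_frac_integral_le[OF q])
        fix u :: real assume u: "u \<in> {0..1}"
        have "t * u \<le> t" "t' * u \<le> t'" using u t t' by (auto intro: mult_left_le)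
        then have "t * u \<in> {0..h}" "t' * u \<in> {0..h}" using u t t' by auto
        moreover have "dist (t' * u) (t * u) \<le> dist t' t"
          using u by (simp add: dist_real_def abs_mult flip: left_diff_distrib)
             (auto intro: mult_left_le)
        ultimately show "norm (g (t' * u) - g (t * u)) \<le> e * (q * Gamma q) / 2"
          using dd[of "t' * u" "t * u"] t' by (simp add: dist_norm)
      qed (auto intro!: continuous_intros gt t t')
      also have "\<dots> = e / 2" using G by (metis nonzero_mult_div_cancel_right times_divide_eq_left less_irrefl mult.right_neutral powr_one_eq_one)
      finally show ?thesis
        using e q frac_integral_diff[OF q, of 1 "\<lambda>u. g (t' * u)" "\<lambda>u. g (t * u)"] gt[OF t] gt[OF t'(1)]
        by (simp add: dist_norm)
    qed
    then show "\<exists>d>0. \<forall>t'\<in>{0..h}. dist t' t < d \<longrightarrow>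
        dist (frac_integral q (\<lambda>u. g (t' * u)) 1) (frac_integral q (\<lambda>u. g (t * u)) 1) < e"
      using d by blast
  qed
  moreover have "continuous_on {0..h} (\<lambda>t. t powr q)"
    using q by (intro continuous_on_powr' continuous_intros) auto
  ultimately have "continuous_on {0..h} (\<lambda>t. t powr q *\<^sub>R frac_integral q (\<lambda>u. g (t * u)) 1)"
    by (intro continuous_on_scaleR)
  then show ?thesis
    by (rule continuous_on_eq) (simp add: frac_integral_rescale[OF q, symmetric])
qed

section \<open>Existence of maximal solutions\<close>

lemma time_interval_ereal: "time_interval (ereal h) = {0..<h}"
  by (auto simp: time_interval_def)

text \<open>Banach's fixed point theorem for the Picard operator of the Volterra equation; the
  factor \<open>t powr q\<close> in \<open>norm_frac_integral_le\<close> makes it a contraction for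
  small \<open>h\<close>.\<close>

lemma local_frac_solution:
  fixes f :: "'a::euclidean_space \<Rightarrow> 'a"
  assumes q: "0 < q" and R: "0 < R" and L: "L-lipschitz_on (cball x0 R) f"
  obtains h x where "0 < h" "frac_solution q f (ereal h) x" "x 0 = x0"
proof -
  define N where "N = q * Gamma q"
  have "Gamma q > 0" using q by (simp add: Gamma_real_pos)
  then have N: "N > 0" using q by (simp add: N_def)
  have L0: "L \<ge> 0" using L by (rule lipschitz_on_nonneg)
  have fc: "continuous_on (cball x0 R) f"
    using L by (rule lipschitz_on_continuous_on)
  then have "bounded (f ` cball x0 R)"
    by (intro compact_imp_bounded compact_continuous_image) auto
  then obtain M where M: "M > 0" "\<And>x. x \<in> cball x0 R \<Longrightarrow> norm (f x) \<le> M"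
    unfolding bounded_pos by auto
  \<comment> \<open>\<open>h\<close> is chosen so that \<open>A * h powr q = 1\<close>: the Picard operator then maps the ball of radius \<open>R\<close>
     into itself and contracts by the factor \<open>1 / 2\<close>.\<close>
  define A where "A = (M / R + 2 * L) / N"
  have A: "A > 0" using M R L0 N by (auto simp: A_def intro!: divide_pos_pos add_pos_nonneg)
  define h where "h = (1 / A) powr (1 / q)"
  have h: "h > 0" "h powr q = 1 / A"
    using A q by (auto simp: h_def powr_powr)
  have tq: "t powr q \<le> 1 / A" if "t \<in> {0..h}" for t
    using powr_mono2[of q t h] that h q by auto
  have AN: "A * N = M / R + 2 * L" using N by (simp add: A_def)
  have hR: "M * t powr q / N \<le> R" if "t \<in> {0..h}" for t
  proof -
    have "M * t powr q / N \<le> M * (1 / A) / N"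
      using tq[OF that] M N by (intro divide_right_mono mult_left_mono) auto
    also have "\<dots> = M / (A * N)" by simp
    also have "\<dots> \<le> M / (M / R)"
      unfolding AN using M R L0 by (intro divide_left_mono mult_pos_pos add_pos_nonneg) auto
    also have "\<dots> = R" using M by simp
    finally show ?thesis .
  qed
  have hL: "L * t powr q / N \<le> 1 / 2" if "t \<in> {0..h}" for t
  proof -
    have "L * t powr q / N \<le> L * (1 / A) / N"
      using tq[OF that] L0 N by (intro divide_right_mono mult_left_mono) auto
    also have "\<dots> = L / (A * N)" by simp
    also have "\<dots> \<le> 1 / 2"
    proof -
      have "L \<le> 1 / 2 * (A * N)" using M R by (simp add: AN)
      then show ?thesis using A N by (simp add: pos_divide_le_eq)
    qed
    finally show ?thesis .
  qed

  \<comment> \<open>The complete space is a ball of bounded continuous functions on the whole line.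
    Its members stay in \<open>cball x0 R\<close> at every time, so \<open>f\<close> is evaluated
    only where it is Lipschitz.\<close>
  define S :: "(real \<Rightarrow>\<^sub>C 'a) set" where "S = cball (const_bcontfun x0) R"
  have S: "apply_bcontfun y t \<in> cball x0 R" if "y \<in> S" for y t
    using that dist_bounded[of "const_bcontfun x0" t y]
    by (simp add: S_def const_bcontfun.rep_eq)
  have fy: "continuous_on X (\<lambda>s. f (apply_bcontfun y s))" if "y \<in> S" for y X
    using S[OF that] by (intro continuous_on_compose2[OF fc]) (auto intro!: continuous_intros)
  define P where "P y = (\<lambda>t. x0 + frac_integral q (\<lambda>s. f (apply_bcontfun y s)) t)" for y
  \<comment> \<open>\<open>P y\<close> is meaningful on \<open>{0..h}\<close> only; it is extended
    by constants to the whole line. On \<open>{0..h}\<close> clamping is the identity, so a fixed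
    point solves the integral equation there.\<close>
  define F where "F y = Bcontfun (ext_cont (P y) 0 h)" for y
  have F: "apply_bcontfun (F y) t = P y (clamp 0 h t)" if "y \<in> S" for y t
  proof -
    have "continuous_on (cbox 0 h) (P y)"
      unfolding P_def cbox_interval
      by (intro continuous_intros continuous_on_frac_integral q fy that)
    then obtain z :: "real \<Rightarrow>\<^sub>C 'a" where "\<And>t. apply_bcontfun z t = P y (clamp 0 h t)"
      using continuous_on_cbox_bcontfunE by metis
    then have "ext_cont (P y) 0 h = apply_bcontfun z"
      by (auto simp: ext_cont_def)
    then show ?thesis
      by (simp add: F_def apply_bcontfun_inverse ext_cont_def fun_eq_iff)
  qed
  have cl: "clamp 0 h t \<in> {0..h}" for t :: real
    using h clamp_in_interval[of 0 h t] by (simp add: cbox_interval)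
  have "\<exists>!y\<in>S. F y = y"
  proof (rule Banach_fix)
    show "complete S" by (simp add: S_def complete_eq_closed)
    have "const_bcontfun x0 \<in> S" using R by (simp add: S_def)
    then show "S \<noteq> {}" by blast
    show "F ` S \<subseteq> S"
    proof
      fix z assume "z \<in> F ` S"
      then obtain y where y: "y \<in> S" "z = F y" by blast
      have "dist (const_bcontfun x0) z \<le> R"
      proof (rule dist_bound)
        fix t
        have "norm (frac_integral q (\<lambda>s. f (apply_bcontfun y s)) (clamp 0 h t))
            \<le> M * clamp 0 h t powr q / (q * Gamma q)"
          using cl[of t] S[OF y(1)] M(2) by (intro norm_frac_integral_le q fy y) auto
        also have "\<dots> \<le> R" using hR[OF cl] by (simp add: N_def)
        finally show "dist (apply_bcontfun (const_bcontfun x0) t) (apply_bcontfun z t) \<le> R"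
          by (simp add: y F P_def const_bcontfun.rep_eq dist_norm)
      qed
      then show "z \<in> S" by (simp add: S_def)
    qed
    fix y z assume yz: "y \<in> S" "z \<in> S"
    show "dist (F y) (F z) \<le> 1 / 2 * dist y z"
    proof (rule dist_bound)
      fix t
      let ?t = "clamp 0 h t"
      have "norm (frac_integral q (\<lambda>s. f (apply_bcontfun y s) - f (apply_bcontfun z s)) ?t)
          \<le> (L * dist y z) * ?t powr q / (q * Gamma q)"
      proof (intro norm_frac_integral_le q continuous_intros fy yz)
        fix s
        have "dist (f (apply_bcontfun y s)) (f (apply_bcontfun z s))
            \<le> L * dist (apply_bcontfun y s) (apply_bcontfun z s)"
          using S yz by (intro lipschitz_onD[OF L])
        also have "\<dots> \<le> L * dist y z"
          by (intro mult_left_mono dist_bounded L0)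
        finally show "norm (f (apply_bcontfun y s) - f (apply_bcontfun z s)) \<le> L * dist y z"
          by (simp add: dist_norm)
      qed (use cl[of t] in auto)
      also have "\<dots> = (L * ?t powr q / N) * dist y z" by (simp add: N_def)
      also have "\<dots> \<le> 1 / 2 * dist y z" by (intro mult_right_mono hL cl) auto
      finally show "dist (apply_bcontfun (F y) t) (apply_bcontfun (F z) t) \<le> 1 / 2 * dist y z"
        using frac_integral_diff[OF q _ fy fy, of ?t y z] cl[of t] yz
        by (simp add: F P_def dist_norm)
    qed
  qed auto
  then obtain y where y: "y \<in> S" "F y = y" by blast
  have eq: "apply_bcontfun y t = x0 + frac_integral q (\<lambda>s. f (apply_bcontfun y s)) t" if "t \<in> {0..h}" for t
    using F[OF y(1), of t] that by (simp add: y P_def cbox_interval)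
  then have y0: "apply_bcontfun y 0 = x0" using h by simp
  have "frac_solution q f (ereal h) (apply_bcontfun y)"
    unfolding frac_solution_def time_interval_ereal
    using h eq by (auto simp: y0 intro!: continuous_intros)
  then show thesis using that h y0 by blast
qed

text \<open>Every time in the half-open interval has a later one still inside, so continuity on all
  \<open>{0..t}\<close> suffices. In this form the condition at \<open>t\<close> involves only
  values on \<open>{0..t}\<close>, which suits gluing along a chain.\<close>

lemma frac_solution_iff:
  "frac_solution q f T x \<longleftrightarrow> 0 < T \<and>
     (\<forall>t\<in>time_interval T. continuous_on {0..t} x \<and>
        x t = x 0 + frac_integral q (\<lambda>s. f (x s)) t)"
proof -
  have sub: "{0..t} \<subseteq> time_interval T" if "t \<in> time_interval T" for t
    using that by (auto simp: time_interval_def intro: le_less_trans[of "ereal _" "ereal t"])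
  have "continuous_on (time_interval T) x"
    if *: "\<And>t. t \<in> time_interval T \<Longrightarrow> continuous_on {0..t} x"
    unfolding continuous_on_eq_continuous_within
  proof
    fix t assume t: "t \<in> time_interval T"
    then obtain t' where t': "t < t'" "ereal t' < T"
      using ereal_dense2[of "ereal t" T] by (auto simp: time_interval_def)
    then have t'T: "t' \<in> time_interval T"
      using t by (auto simp: time_interval_def)
    then have "continuous (at t within {0..t'}) x"
      using * t t' by (auto simp: continuous_on_eq_continuous_within time_interval_def)
    moreover have "at t within time_interval T = at t within {0..t'}"
      using t' sub[OF t'T] by (intro at_within_nhd[of t "{..<t'}"]) (auto simp: time_interval_def)
    ultimately show "continuous (at t within time_interval T) x"
      by simp
  qed
  then show ?thesis
    unfolding frac_solution_def using sub by (meson continuous_on_subset)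
qed

text \<open>Zorn's lemma for graphs ordered by inclusion. Restricting graphs to the time interval
  discards the arbitrary values outside, and inclusion then means continuation.\<close>

lemma maximal_frac_solution_exists:
  assumes "frac_solution q f T\<^sub>0 x\<^sub>0"
  obtains T x where "maximal_frac_solution q f T x" "x 0 = x\<^sub>0 0"
proof -
  define graph :: "ereal \<Rightarrow> (real \<Rightarrow> 'a) \<Rightarrow> (real \<times> 'a) set"
    where "graph T x = (\<lambda>t. (t, x t)) ` time_interval T" for T x
  define \<A> where "\<A> = {graph T x | T x. frac_solution q f T x \<and> x 0 = x\<^sub>0 0}"
  have "\<exists>M\<in>\<A>. \<forall>X\<in>\<A>. M \<subseteq> X \<longrightarrow> X = M"
  proof (rule subset_Zorn_nonempty)
    show "\<A> \<noteq> {}" using assms by (auto simp: \<A>_def)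
    fix C assume C: "C \<noteq> {}" "subset.chain \<A> C"
    then have "\<forall>X\<in>C. \<exists>T x. X = graph T x \<and> frac_solution q f T x \<and> x 0 = x\<^sub>0 0"
      by (auto simp: subset_chain_def \<A>_def)
    then obtain TT xx where *: "\<And>X. X \<in> C \<Longrightarrow>
        X = graph (TT X) (xx X) \<and> frac_solution q f (TT X) (xx X) \<and> xx X 0 = x\<^sub>0 0"
      by metis
    define T where "T = (SUP X\<in>C. TT X)"
    \<comment> \<open>On the union of the chain the choice is forced, by \<open>uniq\<close>;
      elsewhere the value is arbitrary.\<close>
    define x where "x t = (SOME v. (t, v) \<in> \<Union>C)" for t
    have uniq: "v = w" if "(t, v) \<in> \<Union>C" "(t, w) \<in> \<Union>C" for t v w
    proof -
      obtain X Y where XY: "(t, v) \<in> X" "X \<in> C" "(t, w) \<in> Y" "Y \<in> C"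
        using \<open>(t, v) \<in> \<Union>C\<close> \<open>(t, w) \<in> \<Union>C\<close> by blast
      then have "X \<subseteq> Y \<or> Y \<subseteq> X" using C(2) by (auto simp: subset_chain_def)
      then obtain Z where "Z \<in> C" "(t, v) \<in> Z" "(t, w) \<in> Z" using XY by blast
      with *[of Z] have "(t, v) \<in> graph (TT Z) (xx Z)" "(t, w) \<in> graph (TT Z) (xx Z)" by auto
      then show ?thesis by (auto simp: graph_def)
    qed
    have x: "x t = xx X t" if "X \<in> C" "t \<in> time_interval (TT X)" for X t
    proof -
      have "(t, xx X t) \<in> X" using *[OF that(1)] that(2) by (auto simp: graph_def)
      then have "(t, xx X t) \<in> \<Union>C" using that(1) by blast
      then show ?thesis unfolding x_def using uniq by (metis someI)
    qed
    \<comment> \<open>A time lies strictly below the supremum iff it lies strictly below some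
      \<open>TT X\<close>; the half-open intervals make this exact.\<close>
    have T: "t \<in> time_interval T \<longleftrightarrow> (\<exists>X\<in>C. t \<in> time_interval (TT X))" for t
      by (auto simp: T_def time_interval_def less_SUP_iff)
    obtain X0 where X0: "X0 \<in> C" using C(1) by blast
    have "\<Union>C = graph T x"
    proof (intro set_eqI iffI)
      fix z assume "z \<in> \<Union>C"
      then obtain X where "X \<in> C" "z \<in> X" by blast
      with *[of X] have "z \<in> graph (TT X) (xx X)" by blast
      with \<open>X \<in> C\<close> T x show "z \<in> graph T x" by (auto simp: graph_def image_iff)
    next
      fix z assume "z \<in> graph T x"
      then obtain t where t: "z = (t, x t)" "t \<in> time_interval T" by (auto simp: graph_def)
      then obtain X where X: "X \<in> C" "t \<in> time_interval (TT X)" using T by blast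
      then have "z \<in> graph (TT X) (xx X)" using x t by (auto simp: graph_def)
      with X *[of X] show "z \<in> \<Union>C" by blast
    qed
    moreover have "x 0 = x\<^sub>0 0"
      using x[OF X0, of 0] *[OF X0] by (auto simp: frac_solution_def time_interval_def zero_ereal_def)
    moreover have "frac_solution q f T x"
      unfolding frac_solution_iff
    proof (intro conjI ballI)
      have "0 < TT X0" using *[OF X0] by (simp add: frac_solution_def)
      then show "0 < T" using X0 by (auto simp: T_def less_SUP_iff)
      fix t assume "t \<in> time_interval T"
      then obtain X where X: "X \<in> C" "t \<in> time_interval (TT X)" using T by blast
      \<comment> \<open>One member of the chain covers all of \<open>{0..t}\<close>, so the integral
        equation at \<open>t\<close> is inherited from it.\<close>
      have eq: "x s = xx X s" if "s \<in> {0..t}" for s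
        using that X by (intro x) (auto simp: time_interval_def intro: le_less_trans[of "ereal s" "ereal t"])
      have sol: "continuous_on {0..t} (xx X)"
          "xx X t = xx X 0 + frac_integral q (\<lambda>s. f (xx X s)) t"
        using *[OF X(1)] X(2) by (auto simp: frac_solution_iff)
      have t0: "0 \<le> t" using X by (simp add: time_interval_def)
      show "continuous_on {0..t} x"
        using sol(1) by (rule continuous_on_eq) (simp add: eq)
      have "frac_integral q (\<lambda>s. f (xx X s)) t = frac_integral q (\<lambda>s. f (x s)) t"
        by (rule frac_integral_cong) (simp add: eq)
      then show "x t = x 0 + frac_integral q (\<lambda>s. f (x s)) t"
        using sol(2) t0 by (simp add: eq)
    qed
    ultimately show "\<Union>C \<in> \<A>" by (auto simp: \<A>_def)
  qed
  then obtain M where M: "M \<in> \<A>" "\<And>X. X \<in> \<A> \<Longrightarrow> M \<subseteq> X \<Longrightarrow> X = M"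
    by blast
  then obtain T x where Tx: "M = graph T x" "frac_solution q f T x" "x 0 = x\<^sub>0 0"
    unfolding \<A>_def by blast
  note max = M(2)[unfolded Tx(1)]
  have T0: "0 < T" using Tx by (simp add: frac_solution_def)
  have "\<not> (T < T' \<and> frac_solution q f T' y \<and> (\<forall>t\<in>time_interval T. y t = x t))" for T' y
  proof
    assume y: "T < T' \<and> frac_solution q f T' y \<and> (\<forall>t\<in>time_interval T. y t = x t)"
    have "y 0 = x\<^sub>0 0" using y T0 Tx by (auto simp: time_interval_def zero_ereal_def)
    then have "graph T' y \<in> \<A>" using y by (auto simp: \<A>_def)
    moreover have "graph T x \<subseteq> graph T' y"
      using y by (auto simp: graph_def time_interval_def image_iff)
    \<comment> \<open>Maximality makes the two graphs equal, and projecting to the first coordinate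
      recovers their time intervals. A real number between \<open>T\<close> and \<open>T'\<close>
      then gives the contradiction.\<close>
    ultimately have "fst ` graph T' y = fst ` graph T x" using max by metis
    then have eq: "time_interval T' = time_interval T" by (simp add: graph_def image_image)
    obtain r where r: "T < ereal r" "ereal r < T'" using y ereal_dense2 by blast
    have "0 < ereal r" using T0 r(1) by (rule less_trans)
    then have "r \<in> time_interval T'" "r \<notin> time_interval T"
      using r by (auto simp: time_interval_def)
    then show False using eq by simp
  qed
  then have "maximal_frac_solution q f T x" using Tx by (auto simp: maximal_frac_solution_def)
  then show thesis using that Tx by blast
qed

section \<open>The Lagrange system\<close>

text \<open>On the ball all coordinates are bounded by \<open>B\<close>, so a product of two of them
  is Lipschitz with constant \<open>2 * B\<close>. Summing three components in the l1 norm gives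
  \<open>6 * B\<close>.\<close>

lemma lagrange_lipschitz_on_cball:
  assumes "0 \<le> R"
  obtains L where "L-lipschitz_on (cball a R) lagrange"
proof -
  define B where "B = norm a + R"
  have comp: "\<bar>x $ i\<bar> \<le> B" if "x \<in> cball a R" for x i
  proof -
    have "norm x \<le> norm a + dist a x" by (metis dist_norm norm_triangle_sub norm_minus_commute)
    then show ?thesis using that component_le_norm_cart[of x i] by (simp add: B_def)
  qed
  have mult: "\<bar>x $ i * x $ j - y $ i * y $ j\<bar> \<le> 2 * B * dist x y"
    if xy: "x \<in> cball a R" "y \<in> cball a R" for x y :: "real ^ 3" and i j
  proof -
    have d: "\<bar>x $ k - y $ k\<bar> \<le> dist x y" for k
      using component_le_norm_cart[of "x - y" k] by (simp add: dist_norm)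
    have "\<bar>x $ i * x $ j - y $ i * y $ j\<bar> = \<bar>(x $ i - y $ i) * x $ j + y $ i * (x $ j - y $ j)\<bar>"
      by (simp add: algebra_simps)
    also have "\<dots> \<le> \<bar>x $ i - y $ i\<bar> * \<bar>x $ j\<bar> + \<bar>y $ i\<bar> * \<bar>x $ j - y $ j\<bar>"
      by (metis abs_mult abs_triangle_ineq)
    also have "\<dots> \<le> dist x y * B + B * dist x y"
      using comp[OF xy(1), of j] comp[OF xy(2), of i] by (intro add_mono mult_mono d) auto
    finally show ?thesis by simp
  qed
  have "(6 * B)-lipschitz_on (cball a R) lagrange"
  proof (rule lipschitz_onI)
    fix x y assume xy: "x \<in> cball a R" "y \<in> cball a R"
    have "dist (lagrange x) (lagrange y) \<le> (\<Sum>i\<in>UNIV. \<bar>(lagrange x - lagrange y) $ i\<bar>)"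
      unfolding dist_norm by (rule norm_le_l1_cart)
    also have "\<dots> \<le> 6 * B * dist x y"
      using mult[OF xy, of 2 3] mult[OF xy, of 1 3] mult[OF xy, of 1 2]
      by (simp add: sum_3 lagrange_def)
    finally show "dist (lagrange x) (lagrange y) \<le> 6 * B * dist x y" .
  qed (use assms in \<open>simp add: B_def\<close>)
  then show thesis by (rule that)
qed

text \<open>Each sign is the product of the other two, so the signed right-hand side is the product
  of two signed coordinates, each at least \<open>c\<close>.\<close>

lemma lagrange_signed_component:
  fixes \<sigma> x :: "real ^ 3"
  assumes "\<And>k. \<sigma> $ k * \<sigma> $ k = 1" and "\<sigma> $ 1 * \<sigma> $ 2 * \<sigma> $ 3 = 1"
    and "0 \<le> c" and "\<And>k. c \<le> \<sigma> $ k * x $ k"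
  shows "c * c \<le> \<sigma> $ k * lagrange x $ k"
proof -
  have \<sigma>: "\<sigma> $ 1 = \<sigma> $ 2 * \<sigma> $ 3" "\<sigma> $ 2 = \<sigma> $ 1 * \<sigma> $ 3" "\<sigma> $ 3 = \<sigma> $ 1 * \<sigma> $ 2"
    using assms(1)[of 1] assms(1)[of 2] assms(1)[of 3] assms(2) by algebra+
  have p: "c * c \<le> (\<sigma> $ i * x $ i) * (\<sigma> $ j * x $ j)" for i j
    using assms(3,4) by (intro mult_mono) (auto intro: order_trans)
  have "\<sigma> $ 1 * lagrange x $ 1 = (\<sigma> $ 2 * x $ 2) * (\<sigma> $ 3 * x $ 3)"
    by (simp add: lagrange_def \<sigma>(1) mult_ac)
  moreover have "\<sigma> $ 2 * lagrange x $ 2 = (\<sigma> $ 1 * x $ 1) * (\<sigma> $ 3 * x $ 3)"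
    by (simp add: lagrange_def \<sigma>(2) mult_ac)
  moreover have "\<sigma> $ 3 * lagrange x $ 3 = (\<sigma> $ 1 * x $ 1) * (\<sigma> $ 2 * x $ 2)"
    by (simp add: lagrange_def \<sigma>(3) mult_ac)
  ultimately show ?thesis using exhaust_3[of k] p by metis
qed

lemma lagrange_solution_unbounded:
  fixes \<sigma> :: "real ^ 3"
  assumes q: "0 < q" and sol: "frac_solution q lagrange \<infinity> x"
    and \<sigma>: "\<And>k. \<sigma> $ k * \<sigma> $ k = 1" "\<sigma> $ 1 * \<sigma> $ 2 * \<sigma> $ 3 = 1"
    and pos: "\<And>k. 0 < \<sigma> $ k * x 0 $ k"
  shows "\<exists>t\<ge>0. B < norm (x t)"
proof -
  define u where "u k t = \<sigma> $ k * x t $ k" for k t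
  define N where "N = q * Gamma q"
  have "Gamma q > 0" using q by (simp add: Gamma_real_pos)
  then have N: "N > 0" using q by (simp add: N_def)
  have ti: "time_interval \<infinity> = {0..}" by (auto simp: time_interval_def)
  have xc: "continuous_on {0..} x" using sol by (simp add: frac_solution_def ti)
  have uc: "continuous_on {0..} (u k)" for k
    unfolding u_def by (intro continuous_intros xc)
  \<comment> \<open>A combination of fixed basis vectors with polynomial coefficients, from which
    continuity can be read off.\<close>
  have "lagrange = (\<lambda>x. (x $ 2 * x $ 3) *\<^sub>R axis 1 1 + (x $ 1 * x $ 3) *\<^sub>R axis 2 1
      + (x $ 1 * x $ 2) *\<^sub>R axis 3 1)"
    by (simp add: lagrange_def fun_eq_iff vec_eq_iff forall_3 axis_def)
  then have "continuous_on UNIV lagrange"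
    by (elim ssubst) (intro continuous_intros)
  then have lc: "continuous_on {0..t} (\<lambda>s. lagrange (x s))" for t
    by (rule continuous_on_compose2) (auto intro: continuous_on_subset[OF xc])
  have u: "u k t = u k 0 + frac_integral q (\<lambda>s. \<sigma> $ k * lagrange (x s) $ k) t" if "0 \<le> t" for k t
  proof -
    have "x t = x 0 + frac_integral q (\<lambda>s. lagrange (x s)) t"
      using sol that unfolding frac_solution_def ti by blast
    then have "x t $ k = x 0 $ k + frac_integral q (\<lambda>s. lagrange (x s) $ k) t"
      using frac_integral_component[OF q that lc] by (metis vector_add_component)
    then show ?thesis by (simp add: u_def frac_integral_cmult distrib_left)
  qed
  \<comment> \<open>This estimate is used three times: with \<open>c = 0\<close> up to a first exit
    time, with \<open>c = 0\<close> at all times, and finally with a positive \<open>c\<close>.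
    Nothing is assumed at \<open>t\<close> itself.\<close>
  have grow: "u k 0 + c * c * t powr q / N \<le> u k t"
    if "0 \<le> t" "0 \<le> c" "\<And>s k. s \<in> {0..<t} \<Longrightarrow> c \<le> u k s" for k t c
    using frac_integral_ge[OF q \<open>0 \<le> t\<close>, of "\<lambda>s. \<sigma> $ k * lagrange (x s) $ k" "c * c"]
      lagrange_signed_component[OF \<sigma> \<open>0 \<le> c\<close>] that(3) u[OF that(1), of k]
    by (simp add: N_def u_def continuous_on_mult_left continuous_on_component lc)
  have u_pos: "0 < u k t" if "0 \<le> t" for k t
  proof (rule ccontr)
    \<comment> \<open>The times at which some signed component is nonpositive form a finite union of
      closed sets, so the infimum is attained and is a first exit time. There \<open>grow\<close>
      keeps component \<open>j\<close> at or above its positive initial value. If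
      \<open>Inf S = 0\<close>, the interval before it is empty and the same step applies.\<close>
    define S where "S = (\<Union>k. {t \<in> {0..}. u k t \<le> 0})"
    assume "\<not> 0 < u k t"
    then have ne: "S \<noteq> {}" using that by (auto simp: S_def intro: leI)
    have "closed S"
      unfolding S_def by (intro closed_UN ballI continuous_on_closed_Collect_le uc continuous_intros) auto
    moreover have bb: "bdd_below S" unfolding S_def by (rule bdd_belowI[of _ 0]) auto
    ultimately have "Inf S \<in> S" using ne by (intro closed_contains_Inf)
    then obtain j where j: "0 \<le> Inf S" "u j (Inf S) \<le> 0" by (auto simp: S_def)
    have "0 \<le> u i s" if "s \<in> {0..<Inf S}" for s i
    proof -
      have "s \<notin> S" using cInf_lower[OF _ bb] that by fastforce
      then show ?thesis using that by (auto simp: S_def not_le intro: less_imp_le)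
    qed
    then have "u j 0 \<le> u j (Inf S)" using grow[OF j(1), of 0 j] by simp
    then show False using j(2) pos[of j] by (simp add: u_def)
  qed
  define c where "c = Min (range (\<lambda>k. u k 0))"
  have c: "0 < c" "\<And>k. c \<le> u k 0"
    using pos by (auto simp: c_def u_def)
  have c_le: "c \<le> u k t" if "0 \<le> t" for k t
    using grow[OF that, of 0 k] u_pos c(2)[of k] by (fastforce intro: less_imp_le)
  \<comment> \<open>Solves \<open>c * c * t powr q / N = \<bar>B\<bar> + 1\<close>, so the growth
    term alone exceeds \<open>B\<close>.\<close>
  define t where "t = ((\<bar>B\<bar> + 1) * N / (c * c)) powr (1 / q)"
  have t: "0 \<le> t" "t powr q = (\<bar>B\<bar> + 1) * N / (c * c)"
    using q N c(1) by (auto simp: t_def powr_powr)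
  have "\<bar>B\<bar> + 1 \<le> u 1 t"
    using grow[OF t(1), of c 1] c_le c(1) N u_pos[of 0 1] by (simp add: t(2))
  also have "\<dots> \<le> \<bar>\<sigma> $ 1\<bar> * \<bar>x t $ 1\<bar>" by (simp add: u_def flip: abs_mult)
  also have "\<bar>\<sigma> $ 1\<bar> = 1" using \<sigma>(1)[of 1] by (simp add: abs_square_eq_1 flip: power2_eq_square)
  also have "1 * \<bar>x t $ 1\<bar> \<le> norm (x t)" using component_le_norm_cart[of "x t" 1] by simp
  finally show ?thesis using t(1) by (intro exI[of _ t]) auto
qed

text \<open>For \<open>m < 0\<close> the sign at \<open>i\<close> must be negative; a second sign is
  flipped to keep the product 1, which is harmless because the state vanishes in that
  component.\<close>

lemma lagrange_sign_vector:
  obtains \<sigma> :: "real ^ 3" where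
    "\<And>k. \<sigma> $ k * \<sigma> $ k = 1" "\<sigma> $ 1 * \<sigma> $ 2 * \<sigma> $ 3 = 1"
    "\<And>k. 0 \<le> \<sigma> $ k * lagrange_state i m $ k"
proof -
  have "\<exists>\<sigma> :: real ^ 3. (\<forall>k. \<sigma> $ k * \<sigma> $ k = 1) \<and> \<sigma> $ 1 * \<sigma> $ 2 * \<sigma> $ 3 = 1 \<and>
      (\<forall>k. 0 \<le> \<sigma> $ k * lagrange_state i m $ k)"
  proof (cases "0 \<le> m")
    case True
    then show ?thesis
      by (intro exI[of _ "vector [1, 1, 1]"]) (auto simp: forall_3 lagrange_state_def axis_def)
  next
    case False
    consider "i = 1" | "i = 2" | "i = 3" using exhaust_3[of i] by blast
    then show ?thesis
    proof cases
      case 1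
      then show ?thesis using False
        by (intro exI[of _ "vector [- 1, - 1, 1]"]) (auto simp: forall_3 lagrange_state_simps)
    next
      case 2
      then show ?thesis using False
        by (intro exI[of _ "vector [1, - 1, - 1]"]) (auto simp: forall_3 lagrange_state_simps)
    next
      case 3
      then show ?thesis using False
        by (intro exI[of _ "vector [- 1, 1, - 1]"]) (auto simp: forall_3 lagrange_state_simps)
    qed
  qed
  then obtain \<sigma> :: "real ^ 3" where "\<forall>k. \<sigma> $ k * \<sigma> $ k = 1" "\<sigma> $ 1 * \<sigma> $ 2 * \<sigma> $ 3 = 1"
      "\<forall>k. 0 \<le> \<sigma> $ k * lagrange_state i m $ k" by blast
  then show thesis by (intro that[of \<sigma>]) auto
qed

theorem proposition2p4:
  fixes q m :: real and i :: 3
  assumes "0 < q" and "q < 1"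
  shows "equilibrium_state lagrange (lagrange_state i m) \<and>
         unstable_state q lagrange (lagrange_state i m)"
proof
  show "equilibrium_state lagrange (lagrange_state i m)"
    using exhaust_3[of i]
    by (auto simp: equilibrium_state_def lagrange_def lagrange_state_simps vec_eq_iff forall_3)
  let ?e = "lagrange_state i m"
  obtain \<sigma> :: "real ^ 3" where \<sigma>: "\<And>k. \<sigma> $ k * \<sigma> $ k = 1" "\<sigma> $ 1 * \<sigma> $ 2 * \<sigma> $ 3 = 1"
    and e: "\<And>k. 0 \<le> \<sigma> $ k * ?e $ k"
    using lagrange_sign_vector[of i m] by metis
  show "unstable_state q lagrange ?e"
    unfolding unstable_state_def
  proof
    assume "stable_state q lagrange ?e"
    then obtain \<delta> where \<delta>: "\<delta> > 0"
      and stab: "\<And>T x. maximal_frac_solution q lagrange T x \<Longrightarrow> norm (x 0 - ?e) < \<delta> \<Longrightarrow>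
        T = \<infinity> \<and> (\<forall>t\<ge>0. norm (x t - ?e) < 1)"
      unfolding stable_state_def by (metis zero_less_one)
    \<comment> \<open>The summand 1 keeps the denominator positive and makes
      \<open>d * norm \<sigma> < \<delta>\<close> strict.\<close>
    define d where "d = \<delta> / (norm \<sigma> + 1)"
    have d: "d > 0" using \<delta> by (auto simp: d_def intro!: divide_pos_pos add_nonneg_pos)
    obtain L where "L-lipschitz_on (cball (?e + d *\<^sub>R \<sigma>) 1) lagrange"
      using lagrange_lipschitz_on_cball[of 1] by auto
    then obtain h y where y: "frac_solution q lagrange (ereal h) y" "y 0 = ?e + d *\<^sub>R \<sigma>"
      using local_frac_solution[OF assms(1) zero_less_one] by metis
    obtain T x where x: "maximal_frac_solution q lagrange T x" "x 0 = ?e + d *\<^sub>R \<sigma>"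
      using maximal_frac_solution_exists[OF y(1)] y(2) by metis
    have "d * norm \<sigma> < d * (norm \<sigma> + 1)" using d by simp
    also have "\<dots> = \<delta>" by (simp add: d_def add_nonneg_eq_0_iff)
    finally have "norm (x 0 - ?e) < \<delta>" using d by (simp add: x(2))
    from stab[OF x(1) this] have T: "T = \<infinity>" and bd: "\<And>t. 0 \<le> t \<Longrightarrow> norm (x t - ?e) < 1"
      by auto
    \<comment> \<open>The equilibrium contributes a nonnegative amount to each signed component and
      the perturbation contributes exactly \<open>d\<close>.\<close>
    have "0 < \<sigma> $ k * x 0 $ k" for k
    proof -
      have "\<sigma> $ k * x 0 $ k = \<sigma> $ k * ?e $ k + d * (\<sigma> $ k * \<sigma> $ k)"
        by (simp add: x(2) algebra_simps)
      then show ?thesis using e[of k] d \<sigma>(1)[of k] by simp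
    qed
    \<comment> \<open>Stability was instantiated with tolerance 1, so exceeding
      \<open>norm ?e + 1\<close> contradicts it by the triangle inequality.\<close>
    then obtain t where "0 \<le> t" "norm ?e + 1 < norm (x t)"
      using lagrange_solution_unbounded[OF assms(1) _ \<sigma>] x(1) T
      by (metis maximal_frac_solution_def)
    moreover have "norm (x t) \<le> norm ?e + norm (x t - ?e)"
      by (rule norm_triangle_sub)
    ultimately show False using bd[of t] by linarith
  qed
qed

end
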